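(* Let $M\ge 2$, let $\tau_1,\dots,\tau_k$ be the $k$ highest-priority tasks of an arbitrary-deadline sporadic task set scheduled by global fixed-priority preemptive scheduling on $M$ identical processors, and suppose that all jobs of $\tau_1,\dots,\tau_{k-1}$ always meet their deadlines. Task $\tau_k$ is schedulable (all its jobs always meet their deadlines) if for every $\ell\in\mathbb{N}=\{1,2,\dots\}$ there exists $\rho$ with $1\ge\rho\ge \frac{\ell C_k}{(\ell-1)T_k+D_k}$ such that for all $\Delta\ge(\ell-1)T_k+D_k$, $$\ell C_k+\sum_{\tau_i\in \mathbf{T}^{carry}}\omega_i^{diff}(\Delta,\rho)+\sum_{i=1}^{k-1}work_i(\Delta)\ \le\ \Delta\cdot\mu_k ,$$ where $\mu_k=M-(M-1)\rho$, $$\omega_i^{diff}(\Delta,\rho)=\begin{cases}\omega_i^{heavy}(\Delta)-work_i(\Delta)&\text{if }U_i>\rho,\\ \omega_i^{light}(\Delta)-work_i(\Delta)&\text{if }U_i\le\rho,\end{cases}$$ and $\mathbf{T}^{carry}$ is the set of the $\lceil\mu_k\rceil-1$ tasks among $\tau_1,\dots,\tau_{k-1}$ with the largest values of $\omega_i^{diff}(\Delta,\rho)$ (all of these tasks if there are fewer than $\lceil\mu_k\rceil-1$). If $D_k\le T_k$, it suffices that this condition holds for $\ell=1$ only.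
   Context: Model. There are $M\ge2$ identical unit-speed processors. A sporadic task $\tau_i$ has worst-case execution time $C_i>0$, minimum inter-arrival time $T_i>0$, relative deadline $D_i>0$ and utilization $U_i=C_i/T_i$; it is assumed that $C_i\le D_i$ and $U_i\le1$, with no relation required between $D_i$ and $T_i$ (arbitrary deadlines). Task $\tau_i$ releases an infinite sequence of jobs whose consecutive arrivals are at least $T_i$ apart; each job needs at most $C_i$ units of execution, and a job arriving at $t$ must finish by its absolute deadline $t+D_i$. Preemption and migration cost nothing. At any instant at most one job of each task executes, on at most one processor; jobs of the same task are executed in arrival order. Global fixed-priority preemptive scheduling: tasks have unique fixed priorities, $\tau_i$ having higher priority than $\tau_j$ iff $i<j$; at each instant, among the tasks having an arrived and unfinished job, the $M$ highest-priority ones (all of them if fewer than $M$) execute. A task is schedulable if in every schedule so produced, for every legal arrival sequence, all its jobs meet their deadlines. Functions. For $t\ge0$, $work_i(t)=\lfloor t/T_i\rfloor C_i+\min\{C_i,\,t-\lfloor t/T_i\rfloor T_i\}$. $\omega_i^{heavy}(\Delta)=work_i(\Delta+D_i)$. For given $\rho$ with $U_i\le\rho\le1$: $\omega_i^{light}(\Delta)=\Delta$ if $0<\Delta\le C_i$, and for $\Delta>C_i$ $$\omega_i^{light}(\Delta)=\max\{work_i(\Delta),\ (p_2+1)C_i+\max\{0,\,C_i-\rho(T_i-q_2)\}\},$$ where $p_2=\lceil(\Delta-C_i)/T_i\rceil-1$ and $q_2=\Delta-C_i-p_2T_i$. *)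

theory Defs
  imports "HOL-Analysis.Analysis"
begin

text \<open>Tasks are numbered \<open>1, \<dots>, n\<close> by decreasing priority; \<open>C i\<close>, \<open>T i\<close>, \<open>D i\<close> are the
  worst-case execution time, minimum inter-arrival time and relative deadline of task \<open>i\<close>.
  Jobs of a task are numbered from \<open>0\<close>; \<open>A i j\<close> and \<open>e i j\<close> are the arrival time and the actual
  execution requirement of job \<open>j\<close> of task \<open>i\<close>. A requirement of \<open>0\<close> is allowed.\<close>

definition task_set :: "nat \<Rightarrow> (nat \<Rightarrow> real) \<Rightarrow> (nat \<Rightarrow> real) \<Rightarrow> (nat \<Rightarrow> real) \<Rightarrow> bool" where
  "task_set n C T D \<longleftrightarrow>
     (\<forall>i\<in>{1..n}. 0 < C i \<and> 0 < T i \<and> 0 < D i \<and> C i \<le> D i \<and> C i / T i \<le> 1)"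

definition legal_jobs ::
  "nat \<Rightarrow> (nat \<Rightarrow> real) \<Rightarrow> (nat \<Rightarrow> real) \<Rightarrow> (nat \<Rightarrow> nat \<Rightarrow> real) \<Rightarrow> (nat \<Rightarrow> nat \<Rightarrow> real) \<Rightarrow> bool" where
  "legal_jobs n C T A e \<longleftrightarrow>
     (\<forall>i\<in>{1..n}. \<forall>j. A i j + T i \<le> A i (Suc j) \<and> 0 \<le> e i j \<and> e i j \<le> C i)"

text \<open>A schedule is a predicate \<open>run i j t\<close>: job \<open>j\<close> of task \<open>i\<close> executes at time \<open>t\<close>. Processors
  are identical and migration is free, so the processor a job runs on is not recorded.\<close>

text \<open>Execution received strictly before \<open>t\<close> (unit speed).\<close>
definition service :: "(nat \<Rightarrow> nat \<Rightarrow> real \<Rightarrow> bool) \<Rightarrow> nat \<Rightarrow> nat \<Rightarrow> real \<Rightarrow> real" where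
  "service run i j t = measure lborel {s. s < t \<and> run i j s}"

definition pending ::
  "(nat \<Rightarrow> nat \<Rightarrow> real) \<Rightarrow> (nat \<Rightarrow> nat \<Rightarrow> real) \<Rightarrow> (nat \<Rightarrow> nat \<Rightarrow> real \<Rightarrow> bool) \<Rightarrow> nat \<Rightarrow> nat \<Rightarrow> real \<Rightarrow> bool"
where
  "pending A e run i j t \<longleftrightarrow> A i j \<le> t \<and> service run i j t < e i j"

definition active_tasks ::
  "nat \<Rightarrow> (nat \<Rightarrow> nat \<Rightarrow> real) \<Rightarrow> (nat \<Rightarrow> nat \<Rightarrow> real) \<Rightarrow> (nat \<Rightarrow> nat \<Rightarrow> real \<Rightarrow> bool) \<Rightarrow> real \<Rightarrow> nat set"
where
  "active_tasks n A e run t = {i\<in>{1..n}. \<exists>j. pending A e run i j t}"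

text \<open>The \<open>M\<close> smallest elements of \<open>R\<close>, or all of \<open>R\<close> if it has fewer.\<close>
definition highest_priority :: "nat \<Rightarrow> nat set \<Rightarrow> nat set" where
  "highest_priority M R = {i\<in>R. card {h\<in>R. h < i} < M}"

text \<open>At every instant exactly the \<open>M\<close> highest-priority active tasks execute, each one its earliest
  unfinished job. (For legal jobs \<open>A i\<close> is strictly increasing, so job numbers follow arrival
  order.)\<close>
definition gfp_schedule ::
  "nat \<Rightarrow> nat \<Rightarrow> (nat \<Rightarrow> nat \<Rightarrow> real) \<Rightarrow> (nat \<Rightarrow> nat \<Rightarrow> real) \<Rightarrow> (nat \<Rightarrow> nat \<Rightarrow> real \<Rightarrow> bool) \<Rightarrow> bool"
where
  "gfp_schedule M n A e run \<longleftrightarrow>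
     (\<forall>i\<in>{1..n}. \<forall>j. {t. run i j t} \<in> sets lborel \<and>
        (\<forall>t. run i j t \<longleftrightarrow>
           i \<in> highest_priority M (active_tasks n A e run t) \<and>
           pending A e run i j t \<and> (\<forall>j'<j. \<not> pending A e run i j' t)))"

definition schedulable ::
  "nat \<Rightarrow> nat \<Rightarrow> (nat \<Rightarrow> real) \<Rightarrow> (nat \<Rightarrow> real) \<Rightarrow> (nat \<Rightarrow> real) \<Rightarrow> nat \<Rightarrow> bool" where
  "schedulable M n C T D i \<longleftrightarrow>
     (\<forall>A e run. legal_jobs n C T A e \<longrightarrow> gfp_schedule M n A e run \<longrightarrow>
        (\<forall>j. e i j \<le> service run i j (A i j + D i)))"

text \<open>In the next three functions \<open>c\<close>, \<open>p\<close>, \<open>d\<close> stand for the \<open>C\<close>, \<open>T\<close>, \<open>D\<close> of a single task.\<close>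

definition work :: "real \<Rightarrow> real \<Rightarrow> real \<Rightarrow> real" where
  "work c p t = of_int \<lfloor>t / p\<rfloor> * c + min c (t - of_int \<lfloor>t / p\<rfloor> * p)"

definition omega_heavy :: "real \<Rightarrow> real \<Rightarrow> real \<Rightarrow> real \<Rightarrow> real" where
  "omega_heavy c p d \<Delta> = work c p (\<Delta> + d)"

definition omega_light :: "real \<Rightarrow> real \<Rightarrow> real \<Rightarrow> real \<Rightarrow> real" where
  "omega_light c p \<rho> \<Delta> =
     (if \<Delta> \<le> c then \<Delta>
      else let p2 = of_int (\<lceil>(\<Delta> - c) / p\<rceil> - 1); q2 = \<Delta> - c - p2 * p
           in max (work c p \<Delta>) ((p2 + 1) * c + max 0 (c - \<rho> * (p - q2))))"

definition omega_diff ::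
  "(nat \<Rightarrow> real) \<Rightarrow> (nat \<Rightarrow> real) \<Rightarrow> (nat \<Rightarrow> real) \<Rightarrow> real \<Rightarrow> real \<Rightarrow> nat \<Rightarrow> real" where
  "omega_diff C T D \<Delta> \<rho> i =
     (if C i / T i > \<rho> then omega_heavy (C i) (T i) (D i) \<Delta> - work (C i) (T i) \<Delta>
      else omega_light (C i) (T i) \<rho> \<Delta> - work (C i) (T i) \<Delta>)"

definition mu :: "nat \<Rightarrow> real \<Rightarrow> real" where
  "mu M \<rho> = real M - (real M - 1) * \<rho>"

text \<open>\<open>S\<close> consists of \<open>m\<close> elements of \<open>X\<close> with the largest values of \<open>f\<close> (all of \<open>X\<close> if it has fewer
  than \<open>m\<close>). Such an \<open>S\<close> exists for finite \<open>X\<close>; ties may make it non-unique, but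
  the sum of \<open>f\<close> over \<open>S\<close> does not depend on the choice.\<close>
definition largest_subset :: "nat \<Rightarrow> ('a \<Rightarrow> real) \<Rightarrow> 'a set \<Rightarrow> 'a set \<Rightarrow> bool" where
  "largest_subset m f X S \<longleftrightarrow>
     S \<subseteq> X \<and> card S = min m (card X) \<and> (\<forall>i\<in>S. \<forall>j\<in>X - S. f j \<le> f i)"

definition sched_test ::
  "nat \<Rightarrow> nat \<Rightarrow> (nat \<Rightarrow> real) \<Rightarrow> (nat \<Rightarrow> real) \<Rightarrow> (nat \<Rightarrow> real) \<Rightarrow> nat \<Rightarrow> real \<Rightarrow> bool" where
  "sched_test M k C T D l \<rho> \<longleftrightarrow>
     (\<forall>\<Delta> \<ge> (real l - 1) * T k + D k.
        \<exists>Tcarry. largest_subset (nat (\<lceil>mu M \<rho>\<rceil> - 1)) (omega_diff C T D \<Delta> \<rho>) {1..<k} Tcarry \<and>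
          real l * C k + (\<Sum>i\<in>Tcarry. omega_diff C T D \<Delta> \<rho> i) + (\<Sum>i\<in>{1..<k}. work (C i) (T i) \<Delta>)
            \<le> \<Delta> * mu M \<rho>)"

end

theory Submission
  imports Defs
begin

text \<open>Suppose a job of task \<open>k\<close> misses its deadline at \<open>t\<^sub>d\<close>, and let \<open>t\<^sub>a\<close> be the start of the
  interval ending at \<open>t\<^sub>d\<close> on which the task is continuously backlogged. Whenever it
  does not execute there, \<open>M\<close> higher-priority tasks do, so the load on \<open>[t\<^sub>a, t\<^sub>d)\<close> exceeds
  \<open>\<mu>\<^sub>k\<close> times its length. Push the left end back to the earliest \<open>t\<^sub>0 \<le> t\<^sub>a\<close> for which the load on
  \<open>[t\<^sub>0, t\<^sub>d)\<close> is still at least \<open>\<mu>\<^sub>k (t\<^sub>d - t\<^sub>0)\<close>. By minimality every interval ending at \<open>t\<^sub>0\<close> has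
  load below \<open>\<mu>\<^sub>k\<close>. Hence fewer than \<open>\<lceil>\<mu>\<^sub>k\<rceil>\<close> tasks are backlogged at \<open>t\<^sub>0\<close>, and such
  a task, backlogged since \<open>t\<^sub>0 - \<phi>\<close>, has already executed for more than \<open>\<rho> \<phi>\<close>. Bounding the
  work of each task in \<open>[t\<^sub>0, t\<^sub>d)\<close> accordingly contradicts the test for \<open>\<Delta> = t\<^sub>d - t\<^sub>0\<close>.\<close>

subsection \<open>Numeric bounds\<close>

lemma work_mono:
  assumes "0 < c" "0 < p" "x \<le> y"
  shows "work c p x \<le> work c p y"
proof (cases "\<lfloor>x / p\<rfloor> = \<lfloor>y / p\<rfloor>")
  case True
  then show ?thesis using assms by (auto simp: work_def)
next
  case False
  have "\<lfloor>x / p\<rfloor> \<le> \<lfloor>y / p\<rfloor>" using assms by (intro floor_mono divide_right_mono) auto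
  with False have "real_of_int \<lfloor>x / p\<rfloor> + 1 \<le> of_int \<lfloor>y / p\<rfloor>" by linarith
  then have *: "(real_of_int \<lfloor>x / p\<rfloor> + 1) * c \<le> of_int \<lfloor>y / p\<rfloor> * c"
    using assms by (intro mult_right_mono) auto
  have "of_int \<lfloor>y / p\<rfloor> * p \<le> y"
    using of_int_floor_le[of "y / p"] unfolding pos_le_divide_eq[OF assms(2)] .
  then have "0 \<le> min c (y - of_int \<lfloor>y / p\<rfloor> * p)" using assms by simp
  moreover have "min c (x - of_int \<lfloor>x / p\<rfloor> * p) \<le> c" by simp
  moreover have "(of_int \<lfloor>x / p\<rfloor> + 1) * c = of_int \<lfloor>x / p\<rfloor> * c + c" by (simp add: algebra_simps)
  ultimately show ?thesis using * unfolding work_def by linarith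
qed

lemma work_le_self:
  assumes "0 < c" "0 < p" "c \<le> p" "0 \<le> x"
  shows "work c p x \<le> x"
proof -
  have "0 \<le> \<lfloor>x / p\<rfloor>" using assms by simp
  then have "of_int \<lfloor>x / p\<rfloor> * c \<le> of_int \<lfloor>x / p\<rfloor> * p"
    using assms by (intro mult_left_mono) auto
  then show ?thesis unfolding work_def by linarith
qed

text \<open>Needed for \<open>sum_le_largest_subset\<close>, where extra members of the chosen set
  must not lower the sum. The branch \<open>\<Delta> \<le> c\<close> of \<open>omega_light\<close>,
  with value \<open>\<Delta>\<close>, is where \<open>work_le_self\<close> is used.\<close>

lemma omega_diff_nonneg:
  assumes "0 < C i" "0 < T i" "0 < D i" "C i / T i \<le> 1" "0 \<le> \<Delta>"
  shows "0 \<le> omega_diff C T D \<Delta> \<rho> i"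
proof -
  have "C i \<le> T i" using assms by (simp add: field_simps)
  then have "work (C i) (T i) \<Delta> \<le> omega_light (C i) (T i) \<rho> \<Delta>"
    unfolding omega_light_def Let_def using work_le_self[of "C i" "T i" \<Delta>] assms by auto
  moreover have "work (C i) (T i) \<Delta> \<le> omega_heavy (C i) (T i) (D i) \<Delta>"
    unfolding omega_heavy_def using assms by (intro work_mono) auto
  ultimately show ?thesis by (simp add: omega_diff_def)
qed

text \<open>On \<open>\<phi> \<ge> 0\<close> the left-hand side has its local maxima where \<open>\<Delta> + \<phi>\<close> is at the end of the
  rising part of a period; as \<open>c / p \<le> \<rho>\<close>, the first of these dominates the later ones.\<close>
lemma work_minus_le_omega_light:
  assumes "0 < c" "0 < p" "c / p \<le> \<rho>" "\<rho> \<le> 1" "c < \<Delta>" "0 \<le> \<phi>"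
  shows "work c p (\<Delta> + \<phi>) - \<rho> * \<phi> \<le> omega_light c p \<rho> \<Delta>"
proof -
  define q where "q = \<lfloor>(\<Delta> + \<phi>) / p\<rfloor>"
  define Q where "Q = \<lceil>(\<Delta> - c) / p\<rceil>"
  define r where "r = \<Delta> + \<phi> - of_int q * p"
  have w: "work c p (\<Delta> + \<phi>) = of_int q * c + min c r"
    by (simp add: work_def q_def r_def)
  \<comment> \<open>In \<open>omega_light\<close>, \<open>p2 + 1\<close> is \<open>Q\<close> and
    \<open>p - q2\<close> is \<open>Q * p + c - \<Delta>\<close>. The latter is the smallest
    nonnegative shift that takes \<open>\<Delta>\<close> to the end of a rising part.\<close>
  have om: "of_int Q * c + max 0 (c - \<rho> * (of_int Q * p + c - \<Delta>)) \<le> omega_light c p \<rho> \<Delta>"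
    using assms unfolding omega_light_def Let_def Q_def by (simp add: algebra_simps)
  have "0 < c / p" using assms by simp
  then have rho: "0 \<le> \<rho>" using assms by linarith
  show ?thesis
  proof (cases "q < Q")
    case True
    then have "(of_int q + 1) * c \<le> of_int Q * c"
      using assms by (intro mult_right_mono) linarith+
    moreover have "0 \<le> \<rho> * \<phi>" using rho assms by simp
    ultimately show ?thesis using om w by (simp add: algebra_simps)
  next
    case False
    \<comment> \<open>As a function of \<open>r\<close> the left-hand side has slope
      \<open>1 - \<rho>\<close> up to \<open>c\<close> and slope \<open>-\<rho>\<close> afterwards,
      so it peaks at \<open>c\<close>.\<close>
    have a: "min c r - \<rho> * r \<le> c - \<rho> * c"
    proof (cases "r \<le> c")
      case True
      have "(1 - \<rho>) * r \<le> (1 - \<rho>) * c" using True assms by (intro mult_left_mono) auto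
      then show ?thesis using True by (simp add: algebra_simps)
    next
      case False
      then have "\<rho> * c \<le> \<rho> * r" using rho by (intro mult_left_mono) auto
      then show ?thesis using False by simp
    qed
    \<comment> \<open>One more period adds \<open>c\<close> to the work but
      \<open>\<rho> * p\<close> to the subtracted term, so \<open>q\<close> may be lowered to
      \<open>Q\<close>.\<close>
    have "c \<le> \<rho> * p" using assms by (simp add: field_simps)
    then have "of_int Q * (\<rho> * p - c) \<le> of_int q * (\<rho> * p - c)"
      using False by (intro mult_right_mono) auto
    moreover have "\<rho> * \<phi> = \<rho> * (of_int q * p + r - \<Delta>)" by (simp add: r_def)
    ultimately show ?thesis using om w a by (simp add: algebra_simps)
  qed
qed

text \<open>Exchange argument: the members of \<open>K\<close> outside \<open>S\<close> are mapped
  injectively to members of \<open>S\<close> outside \<open>K\<close>, whose values are at least as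
  large. Nonnegativity takes care of the members of \<open>S\<close> that are not hit.\<close>

lemma sum_le_largest_subset:
  assumes "largest_subset m f X S" "finite X" "K \<subseteq> X" "card K \<le> m"
    and nonneg: "\<And>i. i \<in> X \<Longrightarrow> 0 \<le> f i"
  shows "sum f K \<le> sum f S"
proof -
  have S: "S \<subseteq> X" "card S = min m (card X)" and top: "\<forall>i\<in>S. \<forall>j\<in>X - S. f j \<le> f i"
    using assms by (auto simp: largest_subset_def)
  have fin: "finite S" "finite K" using S assms finite_subset by blast+
  show ?thesis
  proof (cases "m \<le> card X")
    case False
    then have "S = X" using S assms by (intro card_subset_eq) auto
    then show ?thesis using assms by (intro sum_mono2) auto
  next
    case True
    have "card (K - S) \<le> card (S - K)"
      using card_le_sym_Diff[of K S] fin S True assms by auto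
    then obtain g where g: "g ` (K - S) \<subseteq> S - K" "inj_on g (K - S)"
      using card_le_inj[of "K - S" "S - K"] fin by auto
    have "sum f (K - S) \<le> (\<Sum>i\<in>K - S. f (g i))"
      using g top assms by (intro sum_mono) blast
    also have "\<dots> = sum f (g ` (K - S))" using g by (simp add: sum.reindex)
    also have "\<dots> \<le> sum f (S - K)" using g fin S nonneg by (intro sum_mono2) auto
    finally have "sum f (K - S) + sum f (K \<inter> S) \<le> sum f (S - K) + sum f (K \<inter> S)" by simp
    then show ?thesis
      using sum.Int_Diff[OF fin(2), of f S] sum.Int_Diff[OF fin(1), of f K]
      by (simp add: Int_commute add.commute)
  qed
qed

subsection \<open>Cumulative length of a set of times\<close>

definition cum :: "real set \<Rightarrow> real \<Rightarrow> real" where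
  "cum X t = measure lborel (X \<inter> {..<t})"

lemma fmeasurable_Icc: "{a..b::real} \<in> fmeasurable lborel"
  by (rule fmeasurableI) (auto simp: emeasure_lborel_Icc_eq)

lemma fmeasurable_Ico: "{a..<b::real} \<in> fmeasurable lborel"
  by (rule fmeasurableI2[OF fmeasurable_Icc[of a b]]) auto

text \<open>The lower bound \<open>m\<close> keeps the part of \<open>X\<close> before any
  \<open>t\<close> of finite length. This matters because \<open>measure\<close> returns 0 on sets
  of infinite measure.\<close>

locale time_set =
  fixes X :: "real set" and m :: real
  assumes meas: "X \<in> sets lborel" and lower: "\<And>x. x \<in> X \<Longrightarrow> m \<le> x"
begin

lemma fmeasurable_cut: "X \<inter> {..<t} \<in> fmeasurable lborel"
proof (rule fmeasurableI2)
  show "{m..t} \<in> fmeasurable lborel" by (rule fmeasurable_Icc)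
  show "X \<inter> {..<t} \<in> sets lborel" using meas by auto
qed (use lower in auto)

lemma cum_diff:
  assumes "a \<le> b"
  shows "cum X b - cum X a = measure lborel (X \<inter> {a..<b})"
proof -
  have eq: "X \<inter> {a..<b} = (X \<inter> {..<b}) - (X \<inter> {..<a})" by auto
  show ?thesis unfolding eq cum_def
    using assms fmeasurableD[OF fmeasurable_cut] fmeasurableD2[OF fmeasurable_cut]
    by (subst measure_Diff) auto
qed

lemma cum_mono: "a \<le> b \<Longrightarrow> cum X a \<le> cum X b"
  using cum_diff[of a b] measure_nonneg[of lborel "X \<inter> {a..<b}"] by linarith

lemma cum_diff_le:
  assumes "a \<le> b"
  shows "cum X b - cum X a \<le> b - a"
proof -
  have "measure lborel (X \<inter> {a..<b}) \<le> measure lborel {a..<b}"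
    using meas by (intro measure_mono_fmeasurable fmeasurable_Ico) auto
  then show ?thesis using cum_diff assms by simp
qed

text \<open>\<open>cum X\<close> is nondecreasing and 1-Lipschitz. Continuity serves the
  intermediate value argument in \<open>sv_le_req\<close> and the closedness of \<open>Z\<close> in
  \<open>deadline_met\<close>.\<close>

lemma isCont_cum: "isCont (cum X) t"
proof -
  have "\<bar>cum X x - cum X t\<bar> \<le> \<bar>x - t\<bar>" for x
    using cum_mono[of x t] cum_mono[of t x] cum_diff_le[of x t] cum_diff_le[of t x]
    by linarith
  then show ?thesis unfolding continuous_at_eps_delta
    by (metis dist_real_def le_less_trans)
qed

lemma cum_eqI:
  assumes "a \<le> b" "X \<inter> {a..<b} = {}"
  shows "cum X b = cum X a"
  using cum_diff[OF assms(1)] assms(2) by simp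

end

lemma cum_nonneg: "0 \<le> cum X t"
  by (simp add: cum_def)

text \<open>Double counting: integrate over \<open>B\<close> the number of sets \<open>X h\<close>
  that contain the point.\<close>

lemma sum_measure_ge_count:
  assumes "finite F" "\<And>h. h \<in> F \<Longrightarrow> X h \<in> sets lborel" "B \<in> fmeasurable lborel"
    and cnt: "\<And>s. s \<in> B \<Longrightarrow> N \<le> card {h\<in>F. s \<in> X h}"
  shows "real N * measure lborel B \<le> (\<Sum>h\<in>F. measure lborel (X h \<inter> B))"
proof -
  have fm: "X h \<inter> B \<in> fmeasurable lborel" if "h \<in> F" for h
    using assms that by (auto intro: fmeasurableI2[OF assms(3)])
  have "real N * measure lborel B = (\<integral>s. real N * indicator B s \<partial>lborel)"
    using assms(3) by (simp add: fmeasurable_def)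
  also have "\<dots> \<le> (\<integral>s. (\<Sum>h\<in>F. indicator (X h \<inter> B) s) \<partial>lborel)"
  proof (rule integral_mono)
    show "integrable lborel (\<lambda>s. real N * indicator B s)"
      using assms(3) by (auto simp: fmeasurable_def)
    show "integrable lborel (\<lambda>s. \<Sum>h\<in>F. indicator (X h \<inter> B) s :: real)"
      using fm by (auto simp: fmeasurable_def)
    fix s
    show "real N * indicator B s \<le> (\<Sum>h\<in>F. indicator (X h \<inter> B) s)"
    proof (cases "s \<in> B")
      case True
      have "(\<Sum>h\<in>F. indicator (X h \<inter> B) s) = (\<Sum>h\<in>F. if s \<in> X h then 1 else (0::real))"
        using True by (intro sum.cong) (auto simp: indicator_def)
      also have "\<dots> = real (card {h\<in>F. s \<in> X h})"
        using assms(1) by (simp add: sum.If_cases Int_def)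
      finally show ?thesis using cnt[OF True] True by simp
    qed simp
  qed
  also have "\<dots> = (\<Sum>h\<in>F. measure lborel (X h \<inter> B))"
    using fm by (subst Bochner_Integration.integral_sum) (auto simp: fmeasurable_def)
  finally show ?thesis .
qed

section \<open>Counting selected tasks\<close>

lemma card_highest_priority:
  assumes "finite R"
  shows "min M (card R) \<le> card (highest_priority M R)"
  using assms
proof (induction R rule: finite_linorder_max_induct)
  case (insert b R)
  have old: "{h \<in> insert b R. h < i} = {h\<in>R. h < i}" if "i \<in> R" for i
    using insert that by auto
  have new: "{h \<in> insert b R. h < b} = R" using insert by auto
  \<comment> \<open>\<open>b\<close> exceeds all of \<open>R\<close>, so it leaves the ranks inside
    \<open>R\<close> unchanged and is itself selected exactly when \<open>R\<close> has fewer than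
    \<open>M\<close> members.\<close>
  have eq: "highest_priority M (insert b R)
      = (if card R < M then insert b (highest_priority M R) else highest_priority M R)"
    using old new insert unfolding highest_priority_def by auto
  have "b \<notin> highest_priority M R" "finite (highest_priority M R)"
    using insert by (auto simp: highest_priority_def)
  then show ?case unfolding eq using insert by (auto simp: min_def split: if_splits)
qed simp

text \<open>Selection of a task depends only on the tasks above it. This lets
  \<open>card_running_below\<close> count running tasks above \<open>i\<close> without looking at
  the others.\<close>

lemma highest_priority_below:
  "highest_priority M {h\<in>R. h < i} = {h\<in>highest_priority M R. h < i}"
proof -
  have "{h' \<in> {h\<in>R. h < i}. h' < h} = {h'\<in>R. h' < h}" if "h < i" for h
    using that by auto
  then show ?thesis unfolding highest_priority_def by auto
qed

subsection \<open>Executions of a schedule\<close>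

definition task_run :: "(nat \<Rightarrow> nat \<Rightarrow> real \<Rightarrow> bool) \<Rightarrow> nat \<Rightarrow> real set" where
  "task_run run i = {t. \<exists>j. run i j t}"

text \<open>Being a difference of \<open>cum\<close>, it is additive without any condition on the
  order of the end points and continuous in each of them.\<close>

definition exec :: "(nat \<Rightarrow> nat \<Rightarrow> real \<Rightarrow> bool) \<Rightarrow> nat \<Rightarrow> real \<Rightarrow> real \<Rightarrow> real" where
  "exec run i a b = cum (task_run run i) b - cum (task_run run i) a"

lemma service_eq_cum: "service run i j t = cum {s. run i j s} t"
  unfolding service_def cum_def by (rule arg_cong[where f = "measure lborel"]) auto

locale gfp =
  fixes M n :: nat and C T D :: "nat \<Rightarrow> real" and A e :: "nat \<Rightarrow> nat \<Rightarrow> real"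
    and run :: "nat \<Rightarrow> nat \<Rightarrow> real \<Rightarrow> bool"
  assumes M: "2 \<le> M"
    and tasks: "task_set n C T D"
    and legal: "legal_jobs n C T A e"
    and sched: "gfp_schedule M n A e run"
begin

abbreviation "active \<equiv> active_tasks n A e run"

abbreviation "sv \<equiv> service run"

lemma task_params:
  assumes "i \<in> {1..n}"
  shows "0 < C i" "0 < T i" "0 < D i" "C i \<le> D i" "C i / T i \<le> 1"
  using tasks assms unfolding task_set_def by blast+

lemma arrival_add:
  assumes "i \<in> {1..n}"
  shows "A i j + real m * T i \<le> A i (j + m)"
proof (induction m)
  case (Suc m)
  have "A i (j + m) + T i \<le> A i (Suc (j + m))"
    using legal assms by (auto simp: legal_jobs_def)
  then show ?case using Suc by (simp add: algebra_simps)
qed simp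

lemma arrival_mono:
  assumes "i \<in> {1..n}" "j \<le> j'"
  shows "A i j \<le> A i j'"
proof -
  have "0 \<le> real (j' - j) * T i" using task_params[OF assms(1)] by simp
  then show ?thesis using arrival_add[OF assms(1), of j "j' - j"] assms(2) by simp
qed

lemma req_bounds:
  assumes "i \<in> {1..n}"
  shows "0 \<le> e i j" "e i j \<le> C i"
  using legal assms by (auto simp: legal_jobs_def)

lemma run_iff:
  assumes "i \<in> {1..n}"
  shows "run i j t \<longleftrightarrow> i \<in> highest_priority M (active t) \<and>
    pending A e run i j t \<and> (\<forall>j'<j. \<not> pending A e run i j' t)"
  using sched assms by (auto simp: gfp_schedule_def)

lemma run_arrived: "i \<in> {1..n} \<Longrightarrow> run i j t \<Longrightarrow> A i j \<le> t"
  using run_iff by (auto simp: pending_def)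

lemma time_set_job:
  assumes "i \<in> {1..n}"
  shows "time_set {t. run i j t} (A i j)"
proof
  show "{t. run i j t} \<in> sets lborel" using sched assms unfolding gfp_schedule_def by blast
qed (use run_arrived assms in auto)

lemma time_set_task:
  assumes "i \<in> {1..n}"
  shows "time_set (task_run run i) (A i 0)"
proof
  have "task_run run i = (\<Union>j. {t. run i j t})" by (auto simp: task_run_def)
  then show "task_run run i \<in> sets lborel"
    using time_set.meas[OF time_set_job[OF assms]] by auto
  show "A i 0 \<le> t" if "t \<in> task_run run i" for t
    using that run_arrived[OF assms] arrival_mono[OF assms, of 0]
    by (fastforce simp: task_run_def intro: order_trans)
qed

lemma sv_mono: "i \<in> {1..n} \<Longrightarrow> s \<le> t \<Longrightarrow> sv i j s \<le> sv i j t"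
  unfolding service_eq_cum by (rule time_set.cum_mono[OF time_set_job])

lemma sv_before:
  assumes "i \<in> {1..n}" "t \<le> A i j"
  shows "sv i j t = 0"
proof -
  have "{s. run i j s} \<inter> {..<t} = {}"
    using run_arrived[OF assms(1)] assms(2) by fastforce
  then show ?thesis by (simp add: service_eq_cum cum_def)
qed

lemma sv_le_elapsed:
  assumes "i \<in> {1..n}"
  shows "sv i j t \<le> max 0 (t - A i j)"
proof (cases "t \<le> A i j")
  case True
  then show ?thesis using sv_before assms by simp
next
  case False
  then show ?thesis
    using time_set.cum_diff_le[OF time_set_job[OF assms], of "A i j" t j]
      sv_before[OF assms, of "A i j" j] by (simp add: service_eq_cum)
qed

text \<open>If the service exceeded the requirement, it would equal it at some earlier
  \<open>u\<close> by continuity. From \<open>u\<close> on the job is not pending, hence does not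
  run, and its service stays constant.\<close>

lemma sv_le_req:
  assumes i: "i \<in> {1..n}"
  shows "sv i j t \<le> e i j"
proof (rule ccontr)
  assume *: "\<not> sv i j t \<le> e i j"
  have "0 < sv i j t" using * req_bounds[OF i, of j] by linarith
  then have "A i j \<le> t" using sv_before[OF i, of t j] by linarith
  moreover have "sv i j (A i j) \<le> e i j" using sv_before[OF i] req_bounds[OF i] by simp
  ultimately obtain u where u: "A i j \<le> u" "u \<le> t" "sv i j u = e i j"
    using IVT[of "cum {s. run i j s}" "A i j" "e i j" t] *
      time_set.isCont_cum[OF time_set_job[OF i]]
    by (auto simp: service_eq_cum)
  have "{s. run i j s} \<inter> {u..<t} = {}"
  proof -
    have False if "run i j s" "u \<le> s" for s
      using that run_iff[OF i] sv_mono[OF i, of u s j] u(3) by (fastforce simp: pending_def)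
    then show ?thesis by auto
  qed
  then have "sv i j t = sv i j u"
    unfolding service_eq_cum by (intro time_set.cum_eqI[OF time_set_job[OF i]] u)
  then show False using u * by simp
qed

text \<open>A selected task is active, so it has a pending job; the pending job of least number is
  the one that runs.\<close>

lemma task_run_iff:
  assumes i: "i \<in> {1..n}"
  shows "t \<in> task_run run i \<longleftrightarrow> i \<in> highest_priority M (active t)"
proof
  assume h: "i \<in> highest_priority M (active t)"
  then obtain j where "pending A e run i j t"
    by (auto simp: highest_priority_def active_tasks_def)
  then have "\<exists>j. pending A e run i j t \<and> (\<forall>j'<j. \<not> pending A e run i j' t)"
    by (rule exists_least_iff[THEN iffD1, OF exI])
  then show "t \<in> task_run run i" using run_iff[OF i] h by (auto simp: task_run_def)
qed (use run_iff[OF i] in \<open>auto simp: task_run_def\<close>)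

lemma card_running_below:
  assumes "i \<le> Suc n"
  shows "min M (card {h\<in>active t. h < i}) \<le> card {h\<in>{1..<i}. t \<in> task_run run h}"
proof -
  have "{h\<in>{1..<i}. t \<in> task_run run h} = {h\<in>highest_priority M (active t). h < i}"
    using assms task_run_iff by (auto simp: highest_priority_def active_tasks_def)
  also have "\<dots> = highest_priority M {h\<in>active t. h < i}"
    by (rule highest_priority_below[symmetric])
  finally show ?thesis
    using card_highest_priority[of "{h\<in>active t. h < i}" M] by (simp add: active_tasks_def)
qed

section \<open>Interference and workload bounds on an interval\<close>

lemma exec_eq:
  assumes "i \<in> {1..n}" "a \<le> b"
  shows "exec run i a b = measure lborel (task_run run i \<inter> {a..<b})"
  unfolding exec_def by (rule time_set.cum_diff[OF time_set_task]) fact+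

lemma exec_nonneg: "i \<in> {1..n} \<Longrightarrow> a \<le> b \<Longrightarrow> 0 \<le> exec run i a b"
  by (simp add: exec_eq)

lemma exec_le: "i \<in> {1..n} \<Longrightarrow> a \<le> b \<Longrightarrow> exec run i a b \<le> b - a"
  unfolding exec_def by (rule time_set.cum_diff_le[OF time_set_task])

lemma exec_add: "exec run i a b + exec run i b c = exec run i a c"
  by (simp add: exec_def)

text \<open>At a time when \<open>i\<close> is active but not selected, at least \<open>M\<close>
  active tasks lie above it, hence at least \<open>M\<close> of those above it run. Counting over
  all such times gives the bound.\<close>

lemma interference:
  assumes i: "i \<in> {1..n}" and "a \<le> b" and act: "\<And>t. a \<le> t \<Longrightarrow> t < b \<Longrightarrow> i \<in> active t"
  shows "real M * (b - a - exec run i a b) \<le> (\<Sum>h\<in>{1..<i}. exec run h a b)"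
proof -
  let ?B = "{a..<b} - task_run run i"
  have ms: "task_run run h \<in> sets lborel" if "h \<in> {1..n}" for h
    using time_set.meas[OF time_set_task[OF that]] .
  have Bf: "?B \<in> fmeasurable lborel"
    using ms[OF i] by (intro fmeasurable_Diff fmeasurable_Ico)
  have "measure lborel ?B = b - a - exec run i a b"
  proof -
    have eq: "?B = {a..<b} - (task_run run i \<inter> {a..<b})" by auto
    show ?thesis unfolding eq using assms ms[OF i]
      by (subst measure_Diff) (auto simp: exec_eq)
  qed
  moreover have "real M * measure lborel ?B
      \<le> (\<Sum>h\<in>{1..<i}. measure lborel (task_run run h \<inter> ?B))"
  proof (rule sum_measure_ge_count)
    show "task_run run h \<in> sets lborel" if "h \<in> {1..<i}" for h
      using ms that i by auto
    fix t assume t: "t \<in> ?B"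
    then have "i \<in> active t" "i \<notin> highest_priority M (active t)"
      using act task_run_iff[OF i] by auto
    then have "M \<le> card {h\<in>active t. h < i}" by (auto simp: highest_priority_def)
    then show "M \<le> card {h\<in>{1..<i}. t \<in> task_run run h}"
      using card_running_below[of i t] i by auto
  qed (use Bf in auto)
  moreover have "(\<Sum>h\<in>{1..<i}. measure lborel (task_run run h \<inter> ?B))
      \<le> (\<Sum>h\<in>{1..<i}. exec run h a b)"
  proof (rule sum_mono)
    fix h assume h: "h \<in> {1..<i}"
    then have hn: "h \<in> {1..n}" using i by auto
    have "measure lborel (task_run run h \<inter> ?B) \<le> measure lborel (task_run run h \<inter> {a..<b})"
      using ms[OF hn] ms[OF i]
      by (intro measure_mono_fmeasurable fmeasurableI2[OF fmeasurable_Ico[of a b]]) auto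
    then show "measure lborel (task_run run h \<inter> ?B) \<le> exec run h a b"
      using exec_eq[OF hn] assms by simp
  qed
  ultimately show ?thesis by simp
qed

text \<open>Union bound over \<open>J\<close>. The term \<open>sv i j b\<close> also includes
  service received before \<open>a\<close>, which only enlarges the right-hand side.\<close>

lemma exec_le_jobs:
  assumes i: "i \<in> {1..n}" and "a \<le> b" "finite J"
    and jobs: "\<And>s j. a \<le> s \<Longrightarrow> s < b \<Longrightarrow> run i j s \<Longrightarrow> j \<in> J"
  shows "exec run i a b \<le> (\<Sum>j\<in>J. sv i j b)"
proof -
  have fm: "{s. run i j s} \<inter> {..<b} \<in> fmeasurable lborel" for j
    by (rule time_set.fmeasurable_cut[OF time_set_job[OF i]])
  have "exec run i a b \<le> measure lborel (\<Union>j\<in>J. {s. run i j s} \<inter> {..<b})"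
    unfolding exec_eq[OF i \<open>a \<le> b\<close>]
  proof (rule measure_mono_fmeasurable)
    show "task_run run i \<inter> {a..<b} \<subseteq> (\<Union>j\<in>J. {s. run i j s} \<inter> {..<b})"
      using jobs by (force simp: task_run_def)
    show "task_run run i \<inter> {a..<b} \<in> sets lborel"
      using time_set.meas[OF time_set_task[OF i]] by auto
    show "(\<Union>j\<in>J. {s. run i j s} \<inter> {..<b}) \<in> fmeasurable lborel"
      using fm assms(3) by (intro fmeasurable.finite_UN) auto
  qed
  also have "\<dots> \<le> (\<Sum>j\<in>J. measure lborel ({s. run i j s} \<inter> {..<b}))"
    using fm assms(3) by (intro measure_UNION_le fmeasurableD)
  finally show ?thesis by (simp add: service_eq_cum cum_def)
qed

text \<open>The arrival bound \<open>c\<close> may precede \<open>a\<close>: this is how carried-in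
  work is charged. At most \<open>q + 1\<close> consecutive jobs can contribute, since arrivals in
  \<open>[c, b)\<close> are \<open>T i\<close> apart.\<close>

lemma exec_le_work:
  assumes i: "i \<in> {1..n}" and "a \<le> b" "c \<le> b"
    and late: "\<And>s j. a \<le> s \<Longrightarrow> s < b \<Longrightarrow> run i j s \<Longrightarrow> c \<le> A i j"
  shows "exec run i a b \<le> work (C i) (T i) (b - c)"
proof (cases "\<exists>j. c \<le> A i j")
  case False
  then have "task_run run i \<inter> {a..<b} = {}"
    using late by (force simp: task_run_def)
  then have "exec run i a b = 0" using exec_eq[OF i] assms by simp
  moreover have "0 \<le> work (C i) (T i) (b - c)"
    using work_mono[of "C i" "T i" 0 "b - c"] task_params[OF i] assms by (simp add: work_def)
  ultimately show ?thesis by simp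
next
  case True
  define j0 where "j0 = (LEAST j. c \<le> A i j)"
  have j0: "c \<le> A i j0" unfolding j0_def by (rule LeastI_ex[OF True])
  define q where "q = nat \<lfloor>(b - c) / T i\<rfloor>"
  have T: "0 < T i" using task_params[OF i] by simp
  have "0 \<le> \<lfloor>(b - c) / T i\<rfloor>" using assms T by simp
  then have q: "real q = of_int \<lfloor>(b - c) / T i\<rfloor>" by (simp add: q_def)
  then have qT: "real q * T i \<le> b - c"
    using of_int_floor_le[of "(b - c) / T i"] unfolding pos_le_divide_eq[OF T] by simp
  have "exec run i a b \<le> (\<Sum>j\<in>{j0..j0 + q}. sv i j b)"
  proof (rule exec_le_jobs[OF i \<open>a \<le> b\<close>])
    fix s j assume s: "a \<le> s" "s < b" "run i j s"
    have "c \<le> A i j" using late s by blast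
    then have "j0 \<le> j" unfolding j0_def by (rule Least_le)
    then have "A i j0 + real (j - j0) * T i \<le> A i j"
      using arrival_add[OF i, of j0 "j - j0"] by simp
    moreover have "A i j < b" using run_arrived[OF i s(3)] s by simp
    ultimately have "real (j - j0) * T i \<le> b - c" using j0 by linarith
    then have "real (j - j0) \<le> (b - c) / T i" using T by (simp add: pos_le_divide_eq)
    then have "int (j - j0) \<le> \<lfloor>(b - c) / T i\<rfloor>" by (simp add: le_floor_iff)
    then have "j - j0 \<le> q" unfolding q_def by linarith
    then show "j \<in> {j0..j0 + q}" using \<open>j0 \<le> j\<close> by auto
  qed simp
  also have "\<dots> = (\<Sum>j\<in>{j0..<j0 + q}. sv i j b) + sv i (j0 + q) b"
    by (simp add: atLeastLessThanSuc_atLeastAtMost[symmetric])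
  \<comment> \<open>The first \<open>q\<close> jobs get at most \<open>C i\<close> each. The last
    one arrives no earlier than \<open>c + q * T i\<close>, so the time left also limits it; this is
    the \<open>min\<close> term of \<open>work\<close>.\<close>
  also have "\<dots> \<le> real q * C i + min (C i) (b - c - real q * T i)"
  proof (rule add_mono)
    have le: "sv i j b \<le> C i" for j
      using sv_le_req[OF i, of j b] req_bounds[OF i, of j] by linarith
    then show "(\<Sum>j\<in>{j0..<j0 + q}. sv i j b) \<le> real q * C i"
      using sum_bounded_above[of "{j0..<j0 + q}" "\<lambda>j. sv i j b" "C i"] by simp
    have "sv i (j0 + q) b \<le> b - c - real q * T i"
      using sv_le_elapsed[OF i, of "j0 + q" b] arrival_add[OF i, of j0 q] j0 qT by linarith
    then show "sv i (j0 + q) b \<le> min (C i) (b - c - real q * T i)" using le by simp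
  qed
  also have "\<dots> = work (C i) (T i) (b - c)" by (simp add: work_def q)
  finally show ?thesis .
qed

text \<open>Strong induction on \<open>j\<close>: while some earlier job is still unfinished when
  the current job arrives, step back to it. The backlogged stretches overlap at those arrivals. The
  bound \<open>j' \<le> j\<close> later confines the jobs executed to \<open>j0..j\<close>.\<close>

lemma backlog_start:
  assumes i: "i \<in> {1..n}" and "A i j \<le> t" "sv i j t < e i j"
  obtains j0 where "j0 \<le> j" "\<And>j'. j' < j0 \<Longrightarrow> e i j' \<le> sv i j' (A i j0)"
    "\<And>s. A i j0 \<le> s \<Longrightarrow> s \<le> t \<Longrightarrow> \<exists>j'. j0 \<le> j' \<and> j' \<le> j \<and> pending A e run i j' s"
proof -
  have "\<exists>j0\<le>j. (\<forall>j'<j0. e i j' \<le> sv i j' (A i j0)) \<and>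
    (\<forall>s. A i j0 \<le> s \<longrightarrow> s \<le> t \<longrightarrow> (\<exists>j'\<ge>j0. j' \<le> j \<and> pending A e run i j' s))"
    using assms(2,3)
  proof (induction j arbitrary: t rule: less_induct)
    case (less j)
    have pend: "pending A e run i j s" if "A i j \<le> s" "s \<le> t" for s
      using that sv_mono[OF i, of s t j] less.prems by (auto simp: pending_def)
    show ?case
    proof (cases "\<forall>j'<j. e i j' \<le> sv i j' (A i j)")
      case True
      then show ?thesis using pend by blast
    next
      case False
      then obtain j' where j': "j' < j" "sv i j' (A i j) < e i j'" by force
      from less.IH[OF j'(1) arrival_mono[OF i] j'(2)] j'(1)
      obtain j0 where j0: "j0 \<le> j'" "\<forall>j'<j0. e i j' \<le> sv i j' (A i j0)"
        "\<forall>s. A i j0 \<le> s \<longrightarrow> s \<le> A i j \<longrightarrow> (\<exists>j''\<ge>j0. j'' \<le> j' \<and> pending A e run i j'' s)"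
        by auto
      have "\<exists>j''\<ge>j0. j'' \<le> j \<and> pending A e run i j'' s" if "A i j0 \<le> s" "s \<le> t" for s
      proof (cases "s \<le> A i j")
        case True
        then show ?thesis using j0 j' that by (meson le_trans less_imp_le)
      next
        case False
        then show ?thesis using pend[of s] j0(1) j'(1) that by (intro exI[of _ j]) auto
      qed
      moreover have "j0 \<le> j" using j0(1) j'(1) by simp
      ultimately show ?thesis using j0(2) by blast
    qed
  qed
  then show ?thesis using that by blast
qed

lemma run_after_start:
  assumes i: "i \<in> {1..n}" and "\<And>j'. j' < j0 \<Longrightarrow> e i j' \<le> sv i j' (A i j0)"
    and "A i j0 \<le> s" "run i j s"
  shows "j0 \<le> j"
proof (rule ccontr)
  assume "\<not> j0 \<le> j"
  then have "e i j \<le> sv i j s"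
    using assms(2)[of j] sv_mono[OF i assms(3), of j] by simp
  then show False using assms(4) run_iff[OF i] by (auto simp: pending_def)
qed

subsection \<open>Carry-in tasks\<close>

text \<open>Strictness of \<open>A i j < t\<close> ensures that the backlog covers an interval of
  positive length before \<open>t\<close>. The load bound \<open>below\<close> is applied to such an
  interval in \<open>exec_le_omega_light\<close> and \<open>card_carry\<close>.\<close>

definition carry :: "nat \<Rightarrow> real \<Rightarrow> nat set" where
  "carry k t = {i\<in>{1..<k}. \<exists>j. A i j < t \<and> sv i j t < e i j}"

text \<open>Jobs that arrived before \<open>t\<close> are finished by \<open>t\<close>, so whatever
  runs later arrived at \<open>t\<close> or after.\<close>

lemma exec_le_no_carry:
  assumes "i \<in> {1..<k}" "k \<le> n" "i \<notin> carry k t" "t \<le> td"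
  shows "exec run i t td \<le> work (C i) (T i) (td - t)"
proof (rule exec_le_work)
  show i: "i \<in> {1..n}" using assms by auto
  fix s j assume s: "t \<le> s" "run i j s"
  show "t \<le> A i j"
  proof (rule ccontr)
    assume "\<not> t \<le> A i j"
    then have "A i j < t" by simp
    then have "e i j \<le> sv i j t" using assms(1,3) unfolding carry_def by force
    also have "\<dots> \<le> sv i j s" by (rule sv_mono[OF i s(1)])
    finally show False using s(2) run_iff[OF i] by (auto simp: pending_def)
  qed
qed (use assms in auto)

text \<open>A job that meets its deadline and still runs at \<open>t\<close> or later arrived after
  \<open>t - D i\<close>, so arrivals are counted from there.\<close>

lemma exec_le_omega_heavy:
  assumes i: "i \<in> {1..n}" and met: "\<And>j. e i j \<le> sv i j (A i j + D i)" and "t \<le> td"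
  shows "exec run i t td \<le> omega_heavy (C i) (T i) (D i) (td - t)"
proof -
  have "exec run i t td \<le> work (C i) (T i) (td - (t - D i))"
  proof (rule exec_le_work[OF i \<open>t \<le> td\<close>])
    fix s j assume s: "t \<le> s" "run i j s"
    have "sv i j s < e i j" using s(2) run_iff[OF i] by (auto simp: pending_def)
    then have "\<not> A i j + D i \<le> s" using met[of j] sv_mono[OF i, of "A i j + D i" s j] by linarith
    with s show "t - D i \<le> A i j" by linarith
  qed (use assms task_params[OF i] in auto)
  then show ?thesis by (simp add: omega_heavy_def algebra_simps)
qed

text \<open>Let \<open>u\<close> be the start of the backlog. Work from \<open>u\<close> to
  \<open>td\<close> is at most \<open>work\<close> of the extended length, and more than
  \<open>\<rho> * (t - u)\<close> of it is already done by \<open>t\<close>;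
  \<open>work_minus_le_omega_light\<close> bounds the rest.\<close>

lemma exec_le_omega_light:
  assumes ik: "i \<in> {1..<k}" "k \<le> n" and rho: "C i / T i \<le> \<rho>" "\<rho> \<le> 1"
    and carry: "i \<in> carry k t" and "t \<le> td"
    and below: "\<And>s. s < t \<Longrightarrow> (\<Sum>h\<in>{1..<k}. exec run h s t) < (t - s) * mu M \<rho>"
  shows "exec run i t td \<le> omega_light (C i) (T i) \<rho> (td - t)"
proof (cases "td - t \<le> C i")
  case True
  then show ?thesis using exec_le[of i t td] assms by (simp add: omega_light_def)
next
  case False
  have i: "i \<in> {1..n}" using ik by auto
  from carry obtain j where j: "A i j < t" "sv i j t < e i j" by (auto simp: carry_def)
  then obtain j0 where j0: "j0 \<le> j" "\<And>j'. j' < j0 \<Longrightarrow> e i j' \<le> sv i j' (A i j0)"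
    and busy: "\<And>s. A i j0 \<le> s \<Longrightarrow> s \<le> t \<Longrightarrow> \<exists>j'. j0 \<le> j' \<and> j' \<le> j \<and> pending A e run i j' s"
    using backlog_start[OF i, of j t] by auto
  define u where "u = A i j0"
  have u: "u < t" using arrival_mono[OF i j0(1)] j by (simp add: u_def)
  have ij: "{1..<k} = {1..<i} \<union> {i..<k}" "i \<in> {i..<k}" using ik by auto
  have "real M * (t - u - exec run i u t) \<le> (\<Sum>h\<in>{1..<i}. exec run h u t)"
  proof (rule interference[OF i])
    show "i \<in> active s" if "u \<le> s" "s < t" for s
      using busy[of s] that i by (auto simp: active_tasks_def u_def)
  qed (use u in simp)
  moreover have "exec run i u t \<le> (\<Sum>h\<in>{i..<k}. exec run h u t)"
    using ij ik u by (intro member_le_sum exec_nonneg) auto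
  ultimately have "real M * (t - u - exec run i u t) + exec run i u t
      \<le> (\<Sum>h\<in>{1..<k}. exec run h u t)"
    unfolding ij(1) by (subst sum.union_disjoint) auto
  also have "\<dots> < (t - u) * mu M \<rho>" by (rule below[OF u])
  \<comment> \<open>With \<open>x\<close> the execution of \<open>i\<close> in
    \<open>[u, t)\<close>, the load there is at least \<open>M * (t - u - x) + x\<close>, yet below
    \<open>mu M \<rho> * (t - u)\<close>. As \<open>M\<close> exceeds 1, this forces
    \<open>x\<close> above \<open>\<rho> * (t - u)\<close>.\<close>
  finally have "(real M - 1) * (\<rho> * (t - u)) < (real M - 1) * exec run i u t"
    by (simp add: mu_def algebra_simps)
  then have "\<rho> * (t - u) < exec run i u t" using M by (simp add: mult_less_cancel_left_pos)
  moreover have "exec run i u td \<le> work (C i) (T i) (td - u)"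
  proof (rule exec_le_work[OF i])
    fix s j' assume "u \<le> s" "run i j' s"
    then have "j0 \<le> j'" using run_after_start[OF i j0(2)] by (auto simp: u_def)
    then show "u \<le> A i j'" unfolding u_def by (rule arrival_mono[OF i])
  qed (use u \<open>t \<le> td\<close> in auto)
  moreover have "work (C i) (T i) (td - t + (t - u)) - \<rho> * (t - u)
      \<le> omega_light (C i) (T i) \<rho> (td - t)"
    using task_params[OF i] rho u False by (intro work_minus_le_omega_light) auto
  ultimately show ?thesis using exec_add[of i u t td] by simp
qed

text \<open>Otherwise at least \<open>N\<close> tasks would be backlogged throughout some
  \<open>[s, t)\<close>, so at least \<open>N\<close> would run there. The load would reach
  \<open>mu M \<rho>\<close> times the length, against \<open>below\<close>.\<close>

lemma card_carry:
  assumes "k \<le> n" "0 \<le> \<rho>"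
    and below: "\<And>s. s < t \<Longrightarrow> (\<Sum>h\<in>{1..<k}. exec run h s t) < (t - s) * mu M \<rho>"
  shows "card (carry k t) \<le> nat (\<lceil>mu M \<rho>\<rceil> - 1)"
proof (rule ccontr)
  assume *: "\<not> card (carry k t) \<le> nat (\<lceil>mu M \<rho>\<rceil> - 1)"
  define N where "N = nat \<lceil>mu M \<rho>\<rceil>"
  have N: "N \<le> card (carry k t)" using * unfolding N_def by linarith
  \<comment> \<open>\<open>N \<le> M\<close> means that the number of processors does not keep
    \<open>N\<close> backlogged tasks from running together.\<close>
  have "0 \<le> (real M - 1) * \<rho>" using M assms by simp
  then have "N \<le> M" unfolding N_def mu_def by linarith
  have fin: "finite (carry k t)" by (simp add: carry_def)
  have "\<exists>J. \<forall>i\<in>carry k t. A i (J i) < t \<and> sv i (J i) t < e i (J i)"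
    by (rule bchoice) (auto simp: carry_def)
  then obtain J where J: "\<And>i. i \<in> carry k t \<Longrightarrow> A i (J i) < t \<and> sv i (J i) t < e i (J i)"
    by blast
  \<comment> \<open>The latest arrival among the witnesses. The entry \<open>t - 1\<close> keeps the
    set nonempty and still lies before \<open>t\<close>.\<close>
  define s where "s = Max (insert (t - 1) ((\<lambda>i. A i (J i)) ` carry k t))"
  have s: "s < t" and sJ: "\<And>i. i \<in> carry k t \<Longrightarrow> A i (J i) \<le> s"
    unfolding s_def using fin J by auto
  have "real N * measure lborel {s..<t}
      \<le> (\<Sum>h\<in>{1..<k}. measure lborel (task_run run h \<inter> {s..<t}))"
  proof (rule sum_measure_ge_count[OF _ _ fmeasurable_Ico])
    show "task_run run h \<in> sets lborel" if "h \<in> {1..<k}" for h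
      using time_set.meas[OF time_set_task, of h] that assms by auto
    fix u assume u: "u \<in> {s..<t}"
    have "pending A e run i (J i) u" if "i \<in> carry k t" for i
      using J[OF that] sJ[OF that] u sv_mono[of i u t "J i"] that assms
      by (force simp: pending_def carry_def)
    then have "carry k t \<subseteq> {h\<in>active u. h < k}"
      using assms by (auto simp: active_tasks_def carry_def)
    then have "card (carry k t) \<le> card {h\<in>active u. h < k}"
      by (intro card_mono) (auto simp: active_tasks_def)
    then show "N \<le> card {h\<in>{1..<k}. u \<in> task_run run h}"
      using card_running_below[of k u] N \<open>N \<le> M\<close> assms by linarith
  qed simp
  also have "\<dots> = (\<Sum>h\<in>{1..<k}. exec run h s t)"
    using s assms by (intro sum.cong) (auto simp: exec_eq)
  also have "\<dots> < (t - s) * mu M \<rho>" by (rule below[OF s])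
  also have "\<dots> \<le> (t - s) * real N"
    using s unfolding N_def by (intro mult_left_mono real_nat_ceiling_ge) auto
  finally show False using s by (simp add: mult.commute)
qed

text \<open>Every task is charged \<open>work\<close>, and only carry-in tasks are charged
  \<open>omega_diff\<close> on top. Since \<open>card_carry\<close> limits their number, their total
  surcharge is at most that of the set \<open>S\<close>.\<close>

lemma exec_sum_le:
  assumes k: "k \<in> {1..n}" and "0 \<le> \<rho>" "\<rho> \<le> 1" "t \<le> td"
    and met: "\<And>i j. i \<in> {1..<k} \<Longrightarrow> e i j \<le> sv i j (A i j + D i)"
    and below: "\<And>s. s < t \<Longrightarrow> (\<Sum>h\<in>{1..<k}. exec run h s t) < (t - s) * mu M \<rho>"
    and S: "largest_subset (nat (\<lceil>mu M \<rho>\<rceil> - 1)) (omega_diff C T D (td - t) \<rho>) {1..<k} S"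
  shows "(\<Sum>h\<in>{1..<k}. exec run h t td)
    \<le> (\<Sum>i\<in>S. omega_diff C T D (td - t) \<rho> i) + (\<Sum>i\<in>{1..<k}. work (C i) (T i) (td - t))"
proof -
  let ?o = "omega_diff C T D (td - t) \<rho>" and ?w = "\<lambda>i. work (C i) (T i) (td - t)"
  have K: "carry k t \<subseteq> {1..<k}" by (auto simp: carry_def)
  have "(\<Sum>h\<in>{1..<k}. exec run h t td)
      \<le> (\<Sum>h\<in>{1..<k}. (if h \<in> carry k t then ?o h else 0) + ?w h)"
  proof (rule sum_mono)
    fix i assume i: "i \<in> {1..<k}"
    show "exec run i t td \<le> (if i \<in> carry k t then ?o i else 0) + ?w i"
      using exec_le_no_carry[OF i _ _ assms(4)] exec_le_omega_heavy[OF _ met[OF i] assms(4)]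
        exec_le_omega_light[OF i _ _ assms(3) _ assms(4) below] i k
      by (auto simp: omega_diff_def)
  qed
  also have "\<dots> = sum ?o (carry k t) + sum ?w {1..<k}"
    using K by (simp add: sum.distrib sum.If_cases Int_absorb1)
  also have "sum ?o (carry k t) \<le> sum ?o S"
  proof (rule sum_le_largest_subset[OF S _ K])
    show "0 \<le> ?o i" if "i \<in> {1..<k}" for i
      using that k assms(4) task_params[of i] by (intro omega_diff_nonneg) auto
    show "card (carry k t) \<le> nat (\<lceil>mu M \<rho>\<rceil> - 1)"
      using card_carry[OF _ assms(2) below] k by auto
  qed simp
  finally show ?thesis by simp
qed

section \<open>The contradiction from a missed deadline\<close>

lemma deadline_met:
  assumes k: "k \<in> {1..n}"
    and met: "\<And>i j. i \<in> {1..<k} \<Longrightarrow> e i j \<le> sv i j (A i j + D i)"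
    and j0: "j0 \<le> j" "\<And>j'. j' < j0 \<Longrightarrow> e k j' \<le> sv k j' (A k j0)"
    and busy: "\<And>s. A k j0 \<le> s \<Longrightarrow> s \<le> A k j + D k \<Longrightarrow>
      \<exists>j'. j0 \<le> j' \<and> j' \<le> j \<and> pending A e run k j' s"
    and l: "l = Suc (j - j0)"
    and rho: "real l * C k / ((real l - 1) * T k + D k) \<le> \<rho>" "\<rho> \<le> 1"
    and test: "sched_test M k C T D l \<rho>"
  shows "e k j \<le> sv k j (A k j + D k)"
proof (rule ccontr)
  assume "\<not> ?thesis"
  then have miss: "sv k j (A k j + D k) < e k j" by simp
  define ta where "ta = A k j0"
  define td where "td = A k j + D k"
  define L where "L = (real l - 1) * T k + D k"
  define E where "E = exec run k ta td"
  define HP where "HP = (\<lambda>a b. \<Sum>h\<in>{1..<k}. exec run h a b)"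
  note p = task_params[OF k]
  \<comment> \<open>The \<open>l\<close> jobs \<open>j0..j\<close> arrive at least
    \<open>T k\<close> apart, which explains the lower bound on \<open>\<Delta>\<close> in the
    test.\<close>
  have L: "L \<le> td - ta" "0 < L"
    using arrival_add[OF k, of j0 "j - j0"] j0(1) l p
    by (auto simp: L_def ta_def td_def intro!: add_nonneg_pos)
  have hn: "h \<in> {1..n}" if "h \<in> {1..<k}" for h using that k by auto
  have rho0: "0 \<le> \<rho>"
  proof -
    have "0 \<le> real l * C k / L" using p L by simp
    then show ?thesis using rho by (simp add: L_def)
  qed
  have mu1: "1 \<le> mu M \<rho>"
  proof -
    have "(real M - 1) * \<rho> \<le> (real M - 1) * 1" using M rho by (intro mult_left_mono) auto
    then show ?thesis by (simp add: mu_def)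
  qed

  \<comment> \<open>Only jobs \<open>j0..j\<close> run in the interval, and job \<open>j\<close>
    gets strictly less than its share. This strictness yields the final contradiction.\<close>
  have El: "E < real l * C k"
  proof -
    have "E \<le> (\<Sum>j'\<in>{j0..j}. sv k j' td)"
      unfolding E_def
    proof (rule exec_le_jobs[OF k])
      fix s j' assume s: "ta \<le> s" "s < td" "run k j' s"
      have "j0 \<le> j'" using run_after_start[OF k j0(2) _ s(3)] s by (simp add: ta_def)
      moreover obtain j'' where "j'' \<le> j" "pending A e run k j'' s"
        using busy[of s] s by (auto simp: ta_def td_def)
      then have "j' \<le> j" using s(3) run_iff[OF k] by (meson le_trans not_le)
      ultimately show "j' \<in> {j0..j}" by simp
    qed (use L in auto)
    also have "\<dots> < (\<Sum>j'\<in>{j0..j}. C k)"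
    proof (rule sum_strict_mono_ex1)
      show "\<forall>j'\<in>{j0..j}. sv k j' td \<le> C k"
        using sv_le_req[OF k] req_bounds[OF k] order_trans by blast
      show "\<exists>j'\<in>{j0..j}. sv k j' td < C k"
        using miss req_bounds(2)[OF k, of j] j0(1) unfolding td_def
        by (intro bexI[of _ j]) auto
    qed simp
    also have "\<dots> = real l * C k" using l j0(1) by (simp add: Suc_diff_le)
    finally show ?thesis .
  qed

  \<comment> \<open>Interference gives a load of at least
    \<open>M * (td - ta) - (M - 1) * E\<close>, and \<open>E\<close> is at most
    \<open>\<rho> * (td - ta)\<close> by the lower bound on \<open>\<rho>\<close>.\<close>
  have start: "(td - ta) * mu M \<rho> \<le> E + HP ta td"
  proof -
    have "real M * (td - ta - E) \<le> HP ta td"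
      unfolding E_def HP_def
    proof (rule interference[OF k])
      show "k \<in> active s" if "ta \<le> s" "s < td" for s
        using busy[of s] that k by (auto simp: active_tasks_def ta_def td_def)
    qed (use L in simp)
    moreover have "E \<le> \<rho> * (td - ta)"
    proof -
      have "real l * C k \<le> \<rho> * L" using rho(1) L(2) by (simp add: L_def[symmetric] pos_divide_le_eq)
      also have "\<dots> \<le> \<rho> * (td - ta)" using rho0 L by (intro mult_left_mono) auto
      finally show ?thesis using El by simp
    qed
    then have "(real M - 1) * E \<le> (real M - 1) * (\<rho> * (td - ta))"
      using M by (intro mult_left_mono) auto
    ultimately show ?thesis by (simp add: mu_def algebra_simps)
  qed

  \<comment> \<open>When the left end moves before \<open>ta\<close>, only the higher-priority work
    grows; the contribution \<open>E\<close> of task \<open>k\<close> stays fixed.\<close>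
  define Z where "Z = {t. t \<le> ta \<and> (td - t) * mu M \<rho> \<le> E + HP t td}"
  define t0 where "t0 = Inf Z"
  have "closed Z"
  proof -
    have "continuous_on UNIV (cum (task_run run h))" if "h \<in> {1..<k}" for h
      using time_set.isCont_cum[OF time_set_task[OF hn[OF that]]]
      by (intro continuous_at_imp_continuous_on) auto
    then show ?thesis unfolding Z_def HP_def exec_def
      by (intro closed_Collect_conj closed_Collect_le continuous_intros) auto
  qed
  moreover have "ta \<in> Z" using start by (simp add: Z_def)
  \<comment> \<open>Since \<open>mu M \<rho>\<close> is at least 1, membership bounds
    \<open>td - t\<close> by the load, and the load is bounded by the total work done before
    \<open>td\<close>.\<close>
  moreover have bdd: "bdd_below Z"
  proof (rule bdd_belowI)
    fix t assume t: "t \<in> Z"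
    then have "(td - t) * 1 \<le> (td - t) * mu M \<rho>"
      using mu1 L by (intro mult_left_mono) (auto simp: Z_def)
    also have "\<dots> \<le> E + HP t td" using t by (simp add: Z_def)
    also have "HP t td \<le> (\<Sum>h\<in>{1..<k}. cum (task_run run h) td)"
      unfolding HP_def exec_def using cum_nonneg by (intro sum_mono) simp
    finally show "td - E - (\<Sum>h\<in>{1..<k}. cum (task_run run h) td) \<le> t" by simp
  qed
  ultimately have t0: "t0 \<in> Z" unfolding t0_def by (intro closed_contains_Inf) auto
  \<comment> \<open>Points before the infimum are outside \<open>Z\<close>; subtracting the
    inequality at \<open>t0\<close> from the strict one at \<open>s\<close> leaves the load on
    \<open>[s, t0)\<close>.\<close>
  have below: "HP s t0 < (t0 - s) * mu M \<rho>" if "s < t0" for s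
  proof -
    have "s \<notin> Z" using that cInf_lower[OF _ bdd] unfolding t0_def by force
    then have "E + HP s td < (td - s) * mu M \<rho>" using that t0 by (auto simp: Z_def)
    moreover have "HP s t0 + HP t0 td = HP s td"
      unfolding HP_def by (simp add: sum.distrib[symmetric] exec_add)
    ultimately show ?thesis using t0 by (auto simp: Z_def algebra_simps)
  qed

  have "L \<le> td - t0" using t0 L by (simp add: Z_def)
  then obtain S where
    S: "largest_subset (nat (\<lceil>mu M \<rho>\<rceil> - 1)) (omega_diff C T D (td - t0) \<rho>) {1..<k} S"
    and le: "real l * C k + (\<Sum>i\<in>S. omega_diff C T D (td - t0) \<rho> i)
      + (\<Sum>i\<in>{1..<k}. work (C i) (T i) (td - t0)) \<le> (td - t0) * mu M \<rho>"
    using test unfolding sched_test_def L_def by blast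
  have "HP t0 td \<le> (\<Sum>i\<in>S. omega_diff C T D (td - t0) \<rho> i)
      + (\<Sum>i\<in>{1..<k}. work (C i) (T i) (td - t0))"
    unfolding HP_def
    using below \<open>L \<le> td - t0\<close> L(2) by (intro exec_sum_le[OF k rho0 rho(2) _ met _ S]) (auto simp: HP_def)
  then show False using le El t0 by (simp add: Z_def)
qed

end

section \<open>The schedulability test\<close>

theorem theorem3p10:
  fixes M n k :: nat and C T D :: "nat \<Rightarrow> real"
  assumes "2 \<le> M"
    and "1 \<le> k" and "k \<le> n"
    and "task_set n C T D"
    and "\<forall>i\<in>{1..<k}. schedulable M n C T D i"
  shows "((\<forall>l\<ge>1. \<exists>\<rho>. real l * C k / ((real l - 1) * T k + D k) \<le> \<rho> \<and> \<rho> \<le> 1 \<and>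
              sched_test M k C T D l \<rho>)
            \<longrightarrow> schedulable M n C T D k) \<and>
         (D k \<le> T k \<longrightarrow>
            (\<exists>\<rho>. C k / D k \<le> \<rho> \<and> \<rho> \<le> 1 \<and> sched_test M k C T D 1 \<rho>)
            \<longrightarrow> schedulable M n C T D k)"
proof (intro conjI impI)
  have k: "k \<in> {1..n}" using assms by auto
  show "schedulable M n C T D k"
    if test: "\<forall>l\<ge>1. \<exists>\<rho>. real l * C k / ((real l - 1) * T k + D k) \<le> \<rho> \<and> \<rho> \<le> 1 \<and>
              sched_test M k C T D l \<rho>"
    unfolding schedulable_def
  proof (intro allI impI)
    fix A e run j assume leg: "legal_jobs n C T A e" and gfp: "gfp_schedule M n A e run"
    interpret gfp M n C T D A e run by unfold_locales (use assms leg gfp in auto)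
    have met: "e i j \<le> service run i j (A i j + D i)" if "i \<in> {1..<k}" for i j
      using that assms(5) leg gfp unfolding schedulable_def by blast
    show "e k j \<le> service run k j (A k j + D k)"
    proof (rule ccontr)
      assume "\<not> ?thesis"
      then have miss: "service run k j (A k j + D k) < e k j" by simp
      have "A k j \<le> A k j + D k" using task_params[OF k] by simp
      from backlog_start[OF k this miss]
      obtain j0 where j0: "j0 \<le> j" "\<And>j'. j' < j0 \<Longrightarrow> e k j' \<le> service run k j' (A k j0)"
        "\<And>s. A k j0 \<le> s \<Longrightarrow> s \<le> A k j + D k \<Longrightarrow>
          \<exists>j'. j0 \<le> j' \<and> j' \<le> j \<and> pending A e run k j' s"
        by metis
      \<comment> \<open>The test is used for \<open>l\<close> equal to the number of jobs from the
        start of the backlog to the late job.\<close>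
      obtain \<rho> where "real (Suc (j - j0)) * C k / ((real (Suc (j - j0)) - 1) * T k + D k) \<le> \<rho>"
        "\<rho> \<le> 1" "sched_test M k C T D (Suc (j - j0)) \<rho>"
        using test[rule_format, of "Suc (j - j0)"] by auto
      from deadline_met[OF k met j0 refl this] show False using miss by simp
    qed
  qed
  show "schedulable M n C T D k"
    if DT: "D k \<le> T k" and "\<exists>\<rho>. C k / D k \<le> \<rho> \<and> \<rho> \<le> 1 \<and> sched_test M k C T D 1 \<rho>"
    unfolding schedulable_def
  proof (intro allI impI)
    fix A e run j assume leg: "legal_jobs n C T A e" and gfp: "gfp_schedule M n A e run"
    interpret gfp M n C T D A e run by unfold_locales (use assms leg gfp in auto)
    have met: "e i j \<le> service run i j (A i j + D i)" if "i \<in> {1..<k}" for i j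
      using that assms(5) leg gfp unfolding schedulable_def by blast
    from that obtain \<rho> where rho: "C k / D k \<le> \<rho>" "\<rho> \<le> 1" "sched_test M k C T D 1 \<rho>" by auto
    \<comment> \<open>By induction all earlier jobs meet their deadlines, which fall no later than
      \<open>A k j\<close> because \<open>D k \<le> T k\<close>. The backlog thus starts with job
      \<open>j\<close> itself, and the test for \<open>l = 1\<close> suffices.\<close>
    show "e k j \<le> service run k j (A k j + D k)"
    proof (induction j rule: less_induct)
      case (less j)
      show ?case
      proof (rule ccontr)
        assume "\<not> ?thesis"
        then have miss: "service run k j (A k j + D k) < e k j" by simp
        have prior: "e k j' \<le> service run k j' (A k j)" if "j' < j" for j'
        proof -
          have "A k j' + D k \<le> A k (j' + 1)" using arrival_add[OF k, of j' 1] DT by simp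
          also have "\<dots> \<le> A k j" using that by (intro arrival_mono[OF k]) auto
          finally show ?thesis using less[OF that] sv_mono[OF k] by (meson order_trans)
        qed
        have pend: "pending A e run k j s" if "A k j \<le> s" "s \<le> A k j + D k" for s
          using that miss sv_mono[OF k that(2), of j] by (auto simp: pending_def)
        have "e k j \<le> service run k j (A k j + D k)"
        proof (rule deadline_met[OF k met le_refl prior _ _ _ rho(2,3)])
          show "\<exists>j'\<ge>j. j' \<le> j \<and> pending A e run k j' s"
            if "A k j \<le> s" "s \<le> A k j + D k" for s
            using pend[OF that] by blast
        qed (use rho in auto)
        then show False using miss by simp
      qed
    qed
  qed
qed

end
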